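(* Let $1<p_1<p_2$ be two integers which are not log-rational to each other, i.e. $\log_{p_1}(p_2)$ is irrational. Let $\alpha=\frac{1}{\log_{p_1}(p_2)}$, an irrational number with $0<\alpha<1$. Let $(s_i)_{i\ge 1}$ be the stabilization sequence of $\alpha$ and let $t_i=\lfloor s_i\alpha\rfloor$. Then: (1) For every $i\ge 1$, no element of the multiplicatively closed set $\{p_1^a p_2^b\mid a,b\in\mathbb{Z}_{\ge 0}\}$ lies strictly between the two integers $p_2^{\,t_{i+1}-1}$ and $p_1^{\,s_i}p_2^{\,t_{i+1}-t_i-1}$ (where $p_2^{\,t_{i+1}-1}<p_1^{\,s_i}p_2^{\,t_{i+1}-t_i-1}$). (2) The lengths $L_i=p_1^{\,s_i}p_2^{\,t_{i+1}-t_i-1}-p_2^{\,t_{i+1}-1}$ of these intervals tend to infinity as $i\to\infty$, faster than a geometric progression with common ratio $p_2$, i.e. $L_i/p_2^{\,i}\to\infty$.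
   Context: Stabilization sequence of an irrational $0<\alpha<1$: choose any sequence of positive rationals $u_n/v_n$ with $\gcd(u_n,v_n)=1$, $u_n<v_n$, converging to $\alpha$. For $i\ge 0$ let $l_i(n)=\lfloor i v_n/u_n\rfloor$ (so $l_i(n)u_n$ is the last multiple of $u_n$ not exceeding $i v_n$; $l_0(n)=0$). Let $J(n)$ be the set consisting of $0$ and of all $1\le j\le v_n$ with $$(l_j(n)+1)u_n-jv_n<\min_{0\le i<j}\{(l_i(n)+1)u_n-iv_n\},$$ and enumerate $J(n)$ increasingly as $0=j_1(n)<j_2(n)<\dots<j_{r_n}(n)$. For each fixed $i$, the values $j_i(n)$ and $l_{j_i(n)}(n)$ are defined and constant for all sufficiently large $n$; denote the eventual value of $l_{j_i(n)}(n)$ by $l_{j_i}$. The stabilization sequence of $\alpha$ is $s_i=l_{j_i}+1$, $i=1,2,3,\dots$ (so $s_1=1$). *)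

theory Defs
  imports Complex_Main
begin

definition approximates :: "(nat \<Rightarrow> nat) \<Rightarrow> (nat \<Rightarrow> nat) \<Rightarrow> real \<Rightarrow> bool" where
  "approximates u v \<alpha> \<longleftrightarrow>
     (\<forall>n. 0 < u n \<and> u n < v n \<and> coprime (u n) (v n)) \<and>
     (\<lambda>n. real (u n) / real (v n)) \<longlonglongrightarrow> \<alpha>"

text \<open>\<open>last_mult U V i\<close> is the floor of \<open>i * V / U\<close> (natural number division), and
  \<open>overshoot U V i\<close> is the amount by which the next multiple of \<open>U\<close> exceeds \<open>i * V\<close>.\<close>

definition last_mult :: "nat \<Rightarrow> nat \<Rightarrow> nat \<Rightarrow> nat" where
  "last_mult U V i = (i * V) div U"

definition overshoot :: "nat \<Rightarrow> nat \<Rightarrow> nat \<Rightarrow> int" where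
  "overshoot U V i = (int (last_mult U V i) + 1) * int U - int i * int V"

definition record_set :: "nat \<Rightarrow> nat \<Rightarrow> nat set" where
  "record_set U V =
     insert 0 {j. 1 \<le> j \<and> j \<le> V \<and> overshoot U V j < (MIN i\<in>{0..<j}. overshoot U V i)}"

text \<open>The increasing enumeration starts at index 1, so \<open>record_index U V 1 = 0\<close>; it is
  meaningful for \<open>1 \<le> i \<le> card (record_set U V)\<close> only.\<close>

definition record_index :: "nat \<Rightarrow> nat \<Rightarrow> nat \<Rightarrow> nat" where
  "record_index U V i = sorted_list_of_set (record_set U V) ! (i - 1)"

text \<open>For irrational \<open>\<alpha>\<close> strictly between 0 and 1 and \<open>i \<ge> 1\<close>, the eventual value below exists
  and is the same for every approximating sequence.\<close>

definition stabilization_seq :: "real \<Rightarrow> nat \<Rightarrow> nat" where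
  "stabilization_seq \<alpha> i =
     (THE m. \<forall>u v. approximates u v \<alpha> \<longrightarrow>
        (\<forall>\<^sub>F n in sequentially.
           i \<le> card (record_set (u n) (v n)) \<and>
           m = last_mult (u n) (v n) (record_index (u n) (v n) i) + 1))"

end

theory Submission
  imports Defs "HOL-Library.Infinite_Set" "HOL-Real_Asymp.Real_Asymp"
begin

text \<open>With \<open>p1 = p2 powr \<alpha>\<close>, an element \<open>p1^a * p2^b\<close> has logarithm \<open>a * \<alpha> + b\<close> to base \<open>p2\<close>,
  and \<open>s i\<close> runs through the records of small fractional part of \<open>m * \<alpha>\<close>. An element between
  the two bounds would yield a smaller fractional part at some \<open>a\<close> below the next record. The
  logarithmic length \<open>\<epsilon>\<close> of the interval is the fractional part of \<open>s i * \<alpha>\<close>. A determinant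
  argument shows that \<open>\<epsilon> \<ge> 1 / s (i + 1)\<close>, so the length is at least a constant times
  \<open>p2 ^ t (i + 1) / t (i + 1)\<close>; and \<open>t\<close> eventually increases by at least 2 per step, so this
  beats \<open>p2 ^ i\<close>.\<close>

section \<open>Positions in enumerated sets\<close>

lemma card_less_enumerate:
  fixes T :: "nat set"
  assumes "infinite T"
  shows "card {y \<in> T. y < enumerate T k} = k"
proof -
  have "{y \<in> T. y < enumerate T k} = enumerate T ` {..<k}"
    using assms enumerate_in_set[OF assms] enumerate_Ex[OF assms] by fastforce
  then show ?thesis
    using inj_enumerate[OF assms] by (simp add: card_image inj_on_subset)
qed

text \<open>Counting smaller elements determines a position both here and for
  \<open>enumerate\<close> on an infinite set, so the two enumerations become comparable.\<close>

lemma sorted_list_of_set_nth_card_less: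
  fixes S :: "'a::linorder set"
  assumes "finite S" "x \<in> S"
  shows "card {y \<in> S. y < x} < card S"
    and "sorted_list_of_set S ! card {y \<in> S. y < x} = x"
proof -
  let ?l = "sorted_list_of_set S"
  have l: "sorted_wrt (<) ?l" "set ?l = S" "length ?l = card S"
    using assms by simp_all
  obtain m where m: "m < length ?l" "?l ! m = x"
    using assms l by (metis in_set_conv_nth)
  have lt: "?l ! i < ?l ! j \<longleftrightarrow> i < j" if "i < length ?l" "j < length ?l" for i j
    using sorted_wrt_nth_less[OF l(1)] that by (metis less_asym linorder_neqE_nat less_irrefl)
  have "{y \<in> S. y < x} = (!) ?l ` {..<m}" (is "?A = ?B")
  proof
    show "?A \<subseteq> ?B"
    proof
      fix y assume "y \<in> ?A"
      then obtain i where "i < length ?l" "?l ! i = y" "y < x"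
        using l(2) by (metis (mono_tags, lifting) in_set_conv_nth mem_Collect_eq)
      then show "y \<in> ?B" using lt[of i m] m by auto
    qed
    show "?B \<subseteq> ?A"
    proof
      fix y assume "y \<in> ?B"
      then obtain i where i: "i < m" "y = ?l ! i" by auto
      then have "y \<in> S" using l m by (metis nth_mem order_less_trans)
      then show "y \<in> ?A" using i lt[of i m] m by auto
    qed
  qed
  moreover have "inj_on ((!) ?l) {..<m}"
    using m(1) by (intro inj_on_nth) auto
  ultimately have "card ?A = m" by (simp add: card_image)
  then show "card ?A < card S" "?l ! card ?A = x" using m l by auto
qed

text \<open>Keeps the condition defining \<open>stabilization_seq\<close> from being vacuous;
  uniqueness of its value depends on this.\<close>

lemma approximates_exists:
  assumes "0 < \<alpha>" "\<alpha> < 1"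
  shows "\<exists>u v. approximates u v \<alpha>"
proof -
  have "\<exists>a b. 0 < a \<and> a < b \<and> coprime a b \<and> \<bar>real a / real b - \<alpha>\<bar> \<le> 1 / real (Suc n)"
    for n
  proof -
    \<comment> \<open>The maximum with 0 keeps the chosen rational positive, and
      \<open>r < \<alpha>\<close> keeps it below 1.\<close>
    have "max 0 (\<alpha> - 1 / real (Suc n)) < \<alpha>" using assms by auto
    then obtain r where r: "r \<in> \<rat>" "max 0 (\<alpha> - 1 / real (Suc n)) < r" "r < \<alpha>"
      using Rats_dense_in_real by blast
    from r(1) obtain a b :: nat where ab: "b \<noteq> 0" "\<bar>r\<bar> = real a / real b" "coprime a b"
      by (rule Rats_abs_nat_div_natE)
    have eq: "real a / real b = r" using ab r by auto
    have "0 < r" "r < 1" using r assms by auto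
    then have "0 < a" "a < b" using ab(1) unfolding eq[symmetric]
      by (auto simp: zero_less_divide_iff divide_less_eq_1)
    moreover have "\<bar>real a / real b - \<alpha>\<bar> \<le> 1 / real (Suc n)" using r eq by auto
    ultimately show ?thesis using ab by blast
  qed
  then obtain u v where uv: "\<And>n. 0 < u n \<and> u n < v n \<and> coprime (u n) (v n)
      \<and> \<bar>real (u n) / real (v n) - \<alpha>\<bar> \<le> 1 / real (Suc n)"
    by metis
  have "(\<lambda>n. 1 / real (Suc n)) \<longlonglongrightarrow> 0"
    using LIMSEQ_inverse_real_of_nat by (simp add: inverse_eq_divide)
  then have "(\<lambda>n. real (u n) / real (v n) - \<alpha>) \<longlonglongrightarrow> 0"
    by (rule tendsto_rabs_zero_cancel[OF tendsto_sandwich[OF _ _ tendsto_const], rotated -1])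
      (use uv in auto)
  then have "(\<lambda>n. real (u n) / real (v n)) \<longlonglongrightarrow> \<alpha>" by (rule LIM_zero_cancel)
  then show ?thesis using uv unfolding approximates_def by blast
qed

lemma mem_record_set_iff:
  "j \<in> record_set U V \<longleftrightarrow> j = 0 \<or> j \<le> V \<and> (\<forall>i<j. overshoot U V j < overshoot U V i)"
  unfolding record_set_def by (cases "j = 0") (auto simp: Suc_le_eq)

lemma finite_record_set: "finite (record_set U V)"
  by (rule finite_subset[of _ "{..V}"]) (auto simp: mem_record_set_iff)

section \<open>Multiples, overshoots and records in the limit\<close>

locale irrational_slope =
  fixes \<alpha> :: real
  assumes pos: "0 < \<alpha>" and less_1: "\<alpha> < 1" and irrational: "\<alpha> \<notin> \<rat>"
begin

definition limit_mult :: "nat \<Rightarrow> nat" where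
  "limit_mult i = nat \<lfloor>real i / \<alpha>\<rfloor>"

text \<open>This is \<open>overshoot U V i\<close> divided by \<open>V\<close>, with
  \<open>U / V\<close> and \<open>last_mult U V i\<close> replaced by their limits.\<close>

definition limit_overshoot :: "nat \<Rightarrow> real" where
  "limit_overshoot i = real (Suc (limit_mult i)) * \<alpha> - real i"

definition limit_records :: "nat set" where
  "limit_records = {j. \<forall>i<j. limit_overshoot j < limit_overshoot i}"

definition nth_record :: "nat \<Rightarrow> nat" where
  "nth_record = enumerate limit_records"

text \<open>A nonzero coefficient would make \<alpha> a quotient of integers; irrationality enters
  the locale's arguments in this form.\<close>

lemma mult_eq_imp_zero:
  assumes "of_int a * \<alpha> = of_int b"
  shows "a = 0"
proof (rule ccontr)
  assume "a \<noteq> 0"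
  then have "\<alpha> = of_int b / of_int a" using assms by (simp add: field_simps)
  then show False using irrational by auto
qed

lemma limit_mult_bounds:
  "real (limit_mult i) * \<alpha> \<le> real i" "real i < real (Suc (limit_mult i)) * \<alpha>"
proof -
  have "real (limit_mult i) = of_int \<lfloor>real i / \<alpha>\<rfloor>"
    using pos by (simp add: limit_mult_def)
  then have "real (limit_mult i) \<le> real i / \<alpha>" "real i / \<alpha> < real (Suc (limit_mult i))"
    by linarith+
  then show "real (limit_mult i) * \<alpha> \<le> real i" "real i < real (Suc (limit_mult i)) * \<alpha>"
    using pos by (simp_all add: field_simps)
qed

lemma limit_mult_strict:
  assumes "0 < i"
  shows "real (limit_mult i) * \<alpha> < real i"
proof -
  have "real (limit_mult i) * \<alpha> \<noteq> real i"
  proof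
    assume "real (limit_mult i) * \<alpha> = real i"
    moreover from this have "limit_mult i = 0"
      using mult_eq_imp_zero[of "int (limit_mult i)" "int i"] by simp
    ultimately show False using assms by simp
  qed
  then show ?thesis using limit_mult_bounds(1)[of i] by simp
qed

lemma limit_overshoot_pos: "0 < limit_overshoot i"
  and limit_overshoot_le: "limit_overshoot i \<le> \<alpha>"
  using limit_mult_bounds[of i] by (simp_all add: limit_overshoot_def algebra_simps)

text \<open>An interval of length \<alpha>, open on the left and closed on the right, contains
  exactly one multiple of \<alpha>.\<close>

lemma limit_overshoot_eqI:
  assumes "real i < real m * \<alpha>" "real m * \<alpha> \<le> real i + \<alpha>"
  shows "m = Suc (limit_mult i)" "limit_overshoot i = real m * \<alpha> - real i"
proof -
  have "m > 0" using assms by (cases m) auto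
  then have "real (m - 1) \<le> real i / \<alpha>" "real i / \<alpha> < real m"
    using assms pos by (simp_all add: field_simps of_nat_diff)
  then have "\<lfloor>real i / \<alpha>\<rfloor> = int (m - 1)"
    using \<open>m > 0\<close> by (intro floor_unique) (auto simp: of_nat_diff)
  then show m: "m = Suc (limit_mult i)"
    using \<open>m > 0\<close> by (simp add: limit_mult_def)
  show "limit_overshoot i = real m * \<alpha> - real i"
    unfolding limit_overshoot_def m ..
qed

text \<open>A tie would be an integer relation between \<alpha> and 1. Without ties, comparisons of
  overshoots carry over to good approximations.\<close>

lemma limit_overshoot_inj:
  assumes "limit_overshoot i = limit_overshoot j"
  shows "i = j"
proof -
  have eq: "of_int (int (limit_mult i) - int (limit_mult j)) * \<alpha> = of_int (int i - int j)"
    using assms by (simp add: limit_overshoot_def algebra_simps)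
  from mult_eq_imp_zero[OF this] have "int (limit_mult i) = int (limit_mult j)" by simp
  with eq show ?thesis by simp
qed

text \<open>Take the last multiple \<open>k * \<epsilon>\<close> of the overshoot \<open>\<epsilon>\<close> of \<open>i\<close> below 1; the next multiple
  passes 1 by less than \<open>\<epsilon>\<close>.\<close>

lemma smaller_limit_overshoot_exists: "\<exists>j. limit_overshoot j < limit_overshoot i"
proof -
  define \<epsilon> where "\<epsilon> = limit_overshoot i"
  define m where "m = Suc (limit_mult i)"
  define k where "k = nat \<lfloor>1 / \<epsilon>\<rfloor>"
  have \<epsilon>: "0 < \<epsilon>" "\<epsilon> \<le> \<alpha>" "\<epsilon> = real m * \<alpha> - real i"
    using limit_overshoot_pos limit_overshoot_le unfolding \<epsilon>_def m_def
    by (auto simp: limit_overshoot_def)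
  have "real k = of_int \<lfloor>1 / \<epsilon>\<rfloor>" using \<epsilon>(1) by (simp add: k_def)
  then have "real k \<le> 1 / \<epsilon>" "1 / \<epsilon> < real k + 1" by linarith+
  then have k: "real k * \<epsilon> \<le> 1" "1 < (real k + 1) * \<epsilon>"
    using \<epsilon>(1) by (simp_all add: field_simps)
  \<comment> \<open>If a multiple hit 1 exactly, the next one would pass 1 by
    \<open>\<epsilon>\<close> itself and nothing would be gained.\<close>
  have "real k * \<epsilon> \<noteq> 1"
  proof
    assume k1: "real k * \<epsilon> = 1"
    have "of_int (int (k * m)) * \<alpha> = of_int (1 + int (k * i))"
      using k1 by (simp add: \<epsilon>(3) algebra_simps)
    from mult_eq_imp_zero[OF this] have "k = 0" unfolding m_def by (metis mult_is_0 nat.simps(3) of_nat_eq_0_iff)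
    then show False using k1 by simp
  qed
  then have k': "real k * \<epsilon> < 1" using k by simp
  \<comment> \<open>\<open>Suc k\<close> copies of \<open>m * \<alpha> - i\<close>, minus 1.\<close>
  define j where "j = Suc k * i + 1"
  have eq: "real (Suc k * m) * \<alpha> - real j = (real k + 1) * \<epsilon> - 1"
    by (simp add: \<epsilon>(3) j_def algebra_simps)
  have "limit_overshoot j = real (Suc k * m) * \<alpha> - real j"
    using eq k k' \<epsilon>(2) by (intro limit_overshoot_eqI(2)) (auto simp: algebra_simps)
  then have "limit_overshoot j < \<epsilon>" using eq k' by (simp add: algebra_simps)
  then show ?thesis unfolding \<epsilon>_def by blast
qed

text \<open>The least index with overshoot below that of \<open>j\<close> is itself a record, and it
  cannot precede \<open>j\<close> because \<open>j\<close> is a record.\<close>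

lemma next_record_exists:
  assumes "j \<in> limit_records" "limit_overshoot i < limit_overshoot j"
  shows "\<exists>k\<in>limit_records. j < k \<and> k \<le> i"
proof -
  define k where "k = (LEAST k. limit_overshoot k < limit_overshoot j)"
  have k: "limit_overshoot k < limit_overshoot j"
    unfolding k_def using assms(2) by (rule LeastI)
  have min: "\<not> limit_overshoot i' < limit_overshoot j" if "i' < k" for i'
    using that unfolding k_def by (rule not_less_Least)
  have "k \<in> limit_records" using k min by (fastforce simp: limit_records_def)
  moreover have "j < k"
    using k assms(1) by (metis (mono_tags, lifting) limit_records_def linorder_neqE_nat
        mem_Collect_eq not_less_iff_gr_or_eq)
  moreover have "k \<le> i" unfolding k_def using assms(2) by (rule Least_le)
  ultimately show ?thesis by blast
qed

lemma zero_limit_record: "0 \<in> limit_records"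
  by (simp add: limit_records_def)

lemma infinite_limit_records: "infinite limit_records"
proof
  assume fin: "finite limit_records"
  define j where "j = Max limit_records"
  have "j \<in> limit_records"
    using fin zero_limit_record by (auto simp: j_def intro!: Max_in)
  then obtain k where "k \<in> limit_records" "j < k"
    using smaller_limit_overshoot_exists next_record_exists by blast
  then show False using Max_ge[OF fin] by (auto simp: j_def leD)
qed

lemma nth_record_mem: "nth_record k \<in> limit_records"
  unfolding nth_record_def by (rule enumerate_in_set[OF infinite_limit_records])

lemma nth_record_Suc_gt: "nth_record k < nth_record (Suc k)"
  unfolding nth_record_def by (rule enumerate_step[OF infinite_limit_records])

text \<open>A smaller overshoot would put a further record strictly between two consecutive
  ones.\<close>

lemma limit_overshoot_nth_record_le:
  assumes "i < nth_record (Suc k)"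
  shows "limit_overshoot (nth_record k) \<le> limit_overshoot i"
proof (rule ccontr)
  assume "\<not> ?thesis"
  then obtain l where l: "l \<in> limit_records" "nth_record k < l" "l \<le> i"
    using next_record_exists[OF nth_record_mem] by (meson not_le)
  then have "nth_record (Suc k) \<le> l"
    unfolding nth_record_def enumerate_Suc''[OF infinite_limit_records]
    by (intro Least_le) auto
  then show False using l assms by simp
qed

lemma limit_overshoot_nth_record_Suc:
  "limit_overshoot (nth_record (Suc k)) < limit_overshoot (nth_record k)"
  using nth_record_mem[of "Suc k"] nth_record_Suc_gt[of k] by (simp add: limit_records_def)

section \<open>Passage from rational approximations to the limit\<close>

lemma eventually_record_set_eq:
  assumes "approximates u v \<alpha>"
  shows "\<forall>\<^sub>F n in sequentially.
    record_set (u n) (v n) \<inter> {..B} = limit_records \<inter> {..B} \<and>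
    (\<forall>j\<le>B. last_mult (u n) (v n) j = limit_mult j)"
proof -
  have uv: "0 < u n" "u n < v n" for n
    using assms by (auto simp: approximates_def)
  have lim: "(\<lambda>n. real (u n) / real (v n)) \<longlonglongrightarrow> \<alpha>"
    using assms by (simp add: approximates_def)
  \<comment> \<open>The rescaled overshoot with its multiplier frozen at the limit value, hence
    continuous in the ratio.\<close>
  define g where "g n i = real (Suc (limit_mult i)) * (real (u n) / real (v n)) - real i" for n i
  have g: "(\<lambda>n. g n i) \<longlonglongrightarrow> limit_overshoot i" for i
    unfolding g_def limit_overshoot_def by (intro tendsto_intros lim)
  \<comment> \<open>Up to \<open>B\<close> only finitely many strict inequalities matter, so they
    all hold for large \<open>n\<close>. Index 0 is left out because its first inequality would read
    \<open>0 < 0\<close>.\<close>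
  have "\<forall>\<^sub>F n in sequentially. \<forall>j\<in>{1..B}.
      real (limit_mult j) * (real (u n) / real (v n)) < real j \<and> 0 < g n j"
  proof (intro eventually_ball_finite ballI eventually_conj)
    fix j assume "j \<in> {1..B}"
    then show "\<forall>\<^sub>F n in sequentially. real (limit_mult j) * (real (u n) / real (v n)) < real j"
      using limit_mult_strict[of j]
      by (intro order_tendstoD(2)[OF tendsto_mult[OF tendsto_const lim]]) auto
    show "\<forall>\<^sub>F n in sequentially. 0 < g n j"
      using limit_overshoot_pos by (rule order_tendstoD(1)[OF g])
  qed auto
  moreover have "\<forall>\<^sub>F n in sequentially. \<forall>j\<in>{..B}. \<forall>i\<in>{..B}.
      limit_overshoot j < limit_overshoot i \<longrightarrow> g n j < g n i"
  proof (intro eventually_ball_finite ballI)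
    fix i j
    show "\<forall>\<^sub>F n in sequentially. limit_overshoot j < limit_overshoot i \<longrightarrow> g n j < g n i"
    proof (cases "limit_overshoot j < limit_overshoot i")
      case True
      then have "\<forall>\<^sub>F n in sequentially. 0 < g n i - g n j"
        by (intro order_tendstoD(1)[OF tendsto_diff[OF g g]]) auto
      then show ?thesis by eventually_elim auto
    qed auto
  qed auto
  ultimately show ?thesis
  proof eventually_elim
    case (elim n)
    have less: "limit_mult j * u n < j * v n" "j * v n < Suc (limit_mult j) * u n"
      if "j \<in> {1..B}" for j
    proof -
      have *: "real (limit_mult j) * (real (u n) / real (v n)) < real j" "0 < g n j"
        using elim that by auto
      have "real (limit_mult j * u n) < real (j * v n)"
        using *(1) uv[of n] by (simp add: field_simps)
      then show "limit_mult j * u n < j * v n" by (simp only: of_nat_less_iff)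
      have "real (j * v n) < real (Suc (limit_mult j) * u n)"
        using *(2) uv[of n] unfolding g_def by (simp add: field_simps)
      then show "j * v n < Suc (limit_mult j) * u n" by (simp only: of_nat_less_iff)
    qed
    have lm: "last_mult (u n) (v n) j = limit_mult j" if "j \<le> B" for j
    proof (cases "j = 0")
      case False
      then show ?thesis using less[of j] that unfolding last_mult_def
        by (intro div_nat_eqI) (auto simp: mult.commute)
    qed (simp add: last_mult_def limit_mult_def)
    \<comment> \<open>At index \<open>u n\<close> the product \<open>u n * v n\<close> is an exact
      multiple of \<open>u n\<close>, contrary to the strict bounds. So every
      \<open>j \<le> B\<close> meets the condition \<open>j \<le> v n\<close> of
      \<open>record_set\<close>.\<close>
    have "B < u n"
    proof (rule ccontr)
      assume "\<not> B < u n"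
      then have "u n \<in> {1..B}" using uv[of n] by auto
      from less[OF this] have "limit_mult (u n) < v n" "v n < Suc (limit_mult (u n))"
        using uv(1)[of n] by (auto simp: mult.commute[of "u n"] simp del: mult_Suc)
      then show False by simp
    qed
    then have B: "j \<le> v n" if "j \<le> B" for j using that uv[of n] by simp
    have os: "real_of_int (overshoot (u n) (v n) j) = real (v n) * g n j" if "j \<le> B" for j
      using uv[of n] by (simp add: overshoot_def lm[OF that] g_def field_simps)
    have cmp: "overshoot (u n) (v n) j < overshoot (u n) (v n) i
        \<longleftrightarrow> limit_overshoot j < limit_overshoot i" if "i < j" "j \<le> B" for i j
    proof -
      have "overshoot (u n) (v n) j < overshoot (u n) (v n) i
          \<longleftrightarrow> real (v n) * g n j < real (v n) * g n i"
        using that by (simp flip: os)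
      also have "\<dots> \<longleftrightarrow> g n j < g n i" using uv[of n] by simp
      \<comment> \<open>Since ties are excluded, the preserved implication, taken in both orders,
        gives an equivalence.\<close>
      also have "\<dots> \<longleftrightarrow> limit_overshoot j < limit_overshoot i"
        using elim(2) limit_overshoot_inj[of i j] that
        by (metis atMost_iff less_imp_le linorder_less_linear order.asym order.strict_trans2)
      finally show ?thesis .
    qed
    show ?case using cmp B lm by (auto simp: mem_record_set_iff limit_records_def)
  qed
qed

text \<open>For large \<open>n\<close> the records up to this one agree with the limit records, so
  it has list position \<open>i - 1\<close>. Truncated subtraction covers
  \<open>i = 0\<close>.\<close>

lemma stabilization_seq_eq: "stabilization_seq \<alpha> i = Suc (limit_mult (nth_record (i - 1)))"
proof -
  let ?x = "nth_record (i - 1)"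
  let ?P = "\<lambda>m. \<forall>u v. approximates u v \<alpha> \<longrightarrow>
        (\<forall>\<^sub>F n in sequentially.
           i \<le> card (record_set (u n) (v n)) \<and>
           m = last_mult (u n) (v n) (record_index (u n) (v n) i) + 1)"
  have ev: "?P (Suc (limit_mult ?x))"
  proof (intro allI impI)
    fix u v assume "approximates u v \<alpha>"
    from eventually_record_set_eq[OF this, of ?x]
    show "\<forall>\<^sub>F n in sequentially.
           i \<le> card (record_set (u n) (v n)) \<and>
           Suc (limit_mult ?x) = last_mult (u n) (v n) (record_index (u n) (v n) i) + 1"
    proof eventually_elim
      case (elim n)
      let ?S = "record_set (u n) (v n)"
      have "?x \<in> ?S" using elim nth_record_mem by auto
      note nth = sorted_list_of_set_nth_card_less[OF finite_record_set this]
      have "{y \<in> ?S. y < ?x} = {y \<in> limit_records. y < ?x}"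
        using elim by fastforce
      then have "card {y \<in> ?S. y < ?x} = i - 1"
        using card_less_enumerate[OF infinite_limit_records] by (simp add: nth_record_def)
      with nth have "i - 1 < card ?S" "sorted_list_of_set ?S ! (i - 1) = ?x" by simp_all
      then show ?case using elim by (simp add: record_index_def)
    qed
  qed
  moreover have "m = Suc (limit_mult ?x)" if m: "?P m" for m
  proof -
    obtain u v where "approximates u v \<alpha>" using approximates_exists[OF pos less_1] by blast
    with m ev have "\<forall>\<^sub>F n in sequentially. m = Suc (limit_mult ?x)"
      by (smt (verit) eventually_elim2)
    then show ?thesis by simp
  qed
  ultimately show ?thesis unfolding stabilization_seq_def by (rule the_equality)
qed

section \<open>Size of the overshoots and growth of the records\<close>

lemma floor_Suc_limit_mult: "\<lfloor>real (Suc (limit_mult i)) * \<alpha>\<rfloor> = int i"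
  using limit_overshoot_pos[of i] limit_overshoot_le[of i] less_1
  by (intro floor_unique) (auto simp: limit_overshoot_def)

text \<open>The points \<open>(s, t)\<close> attached to consecutive records have an integer determinant, which
  is positive because \<open>s\<close> increases while the overshoot decreases.\<close>

lemma limit_overshoot_nth_record_ge:
  "1 / real (Suc (limit_mult (nth_record (Suc k)))) \<le> limit_overshoot (nth_record k)"
proof -
  define i j where "i = nth_record k" and "j = nth_record (Suc k)"
  define a b where "a = Suc (limit_mult i)" and "b = Suc (limit_mult j)"
  have ij: "i < j" "limit_overshoot j < limit_overshoot i"
    using nth_record_Suc_gt limit_overshoot_nth_record_Suc by (auto simp: i_def j_def)
  have ov: "limit_overshoot i = real a * \<alpha> - real i" "limit_overshoot j = real b * \<alpha> - real j"
    by (simp_all add: limit_overshoot_def a_def b_def)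
  have ab: "a \<le> b" unfolding a_def b_def limit_mult_def using ij(1) pos
    by (auto intro!: nat_mono floor_mono divide_right_mono)
  have det: "real_of_int (int a * int j - int b * int i)
      = real b * limit_overshoot i - real a * limit_overshoot j"
    by (simp add: ov algebra_simps)
  have "real a * limit_overshoot j \<le> real b * limit_overshoot j"
    using ab limit_overshoot_pos[of j] by (intro mult_right_mono) auto
  also have "\<dots> < real b * limit_overshoot i" using ij by (simp add: b_def)
  finally have "real_of_int (int a * int j - int b * int i) > 0" unfolding det by simp
  then have "1 \<le> int a * int j - int b * int i" unfolding of_int_0_less_iff by simp
  then have "1 \<le> real_of_int (int a * int j - int b * int i)" by (simp only: of_int_1_le_iff)
  then have "1 \<le> real b * limit_overshoot i"
    unfolding det using limit_overshoot_pos[of j]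
    by (smt (verit) mult_nonneg_nonneg of_nat_0_le_iff)
  then show ?thesis unfolding i_def[symmetric] j_def[symmetric] b_def[symmetric]
    by (simp add: b_def field_simps)
qed

text \<open>A gap of 1 between consecutive records lowers the overshoot by at least the distance
  from 1 to the largest multiple of \<open>\<alpha>\<close> below 1, which can happen only finitely often.\<close>

lemma eventually_nth_record_gap: "\<forall>\<^sub>F k in sequentially. nth_record k + 2 \<le> nth_record (Suc k)"
proof -
  define f where "f k = limit_overshoot (nth_record k)" for k
  define c where "c = 1 - real (limit_mult 1) * \<alpha>"
  have "c > 0" using limit_mult_strict[of 1] by (simp add: c_def)
  \<comment> \<open>Positive decreasing overshoots converge, so their successive drops eventually
    stay below \<open>c\<close>.\<close>
  have "decseq f"
    unfolding decseq_Suc_iff f_def using limit_overshoot_nth_record_Suc less_imp_le by blast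
  then obtain l where l: "f \<longlonglongrightarrow> l"
    using limit_overshoot_pos less_imp_le unfolding f_def by (metis decseq_convergent)
  have "(\<lambda>k. f k - f (Suc k)) \<longlonglongrightarrow> l - l"
    using l by (intro tendsto_diff LIMSEQ_Suc)
  then have "\<forall>\<^sub>F k in sequentially. f k - f (Suc k) < c"
    using \<open>c > 0\<close> by (auto intro: order_tendstoD)
  then show ?thesis
  proof eventually_elim
    case (elim k)
    show ?case
    proof (rule ccontr)
      assume "\<not> ?case"
      then have 1: "nth_record (Suc k) = Suc (nth_record k)"
        using nth_record_Suc_gt[of k] by simp
      define m where "m = int (limit_mult (nth_record (Suc k))) - int (limit_mult (nth_record k))"
      have drop: "f k - f (Suc k) = 1 - of_int m * \<alpha>"
        by (simp add: f_def limit_overshoot_def 1 m_def algebra_simps)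
      have "f (Suc k) < f k" by (simp add: f_def limit_overshoot_nth_record_Suc)
      then have "of_int m * \<alpha> < 1" using drop by simp
      then have "real_of_int m * \<alpha> < real (Suc (limit_mult 1)) * \<alpha>"
        using limit_mult_bounds(2)[of 1] by simp
      then have "real_of_int m < real (Suc (limit_mult 1))" using pos by simp
      then have "m \<le> int (limit_mult 1)" by linarith
      then have "real_of_int m \<le> real (limit_mult 1)" by linarith
      then have "real_of_int m * \<alpha> \<le> real (limit_mult 1) * \<alpha>" using pos by simp
      then show False using elim drop by (simp add: c_def)
    qed
  qed
qed

text \<open>Gaps of at least 2 are summed from some \<open>N\<close> on, and
  \<open>K = 2 * N\<close> absorbs the beginning. Thus \<open>nth_record k - k\<close> is at least
  half of \<open>nth_record k\<close>, up to a constant.\<close>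

lemma nth_record_ge_double: "\<exists>K. \<forall>k. 2 * k \<le> nth_record k + K"
proof -
  obtain N where N: "\<And>k. k \<ge> N \<Longrightarrow> nth_record k + 2 \<le> nth_record (Suc k)"
    using eventually_nth_record_gap unfolding eventually_sequentially by blast
  have "2 * k \<le> nth_record k + 2 * N" for k
  proof (cases "k \<le> N")
    case False
    then have "N \<le> k" by simp
    then show ?thesis
    proof (induction k rule: dec_induct)
      case (step k)
      then show ?case using N[of k] by simp
    qed simp
  qed simp
  then show ?thesis by blast
qed

end

section \<open>The gaps between products of powers and their lengths\<close>

theorem theorem2p2:
  fixes p1 p2 :: int and \<alpha> :: real and s :: "nat \<Rightarrow> nat" and t :: "nat \<Rightarrow> int"
    and lo hi :: "nat \<Rightarrow> real"
  assumes "1 < p1" and "p1 < p2"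
    and "log (real_of_int p1) (real_of_int p2) \<notin> \<rat>"
    and "\<alpha> = 1 / log (real_of_int p1) (real_of_int p2)"
    and "\<And>i. s i = stabilization_seq \<alpha> i"
    and "\<And>i. t i = \<lfloor>real (s i) * \<alpha>\<rfloor>"
    and "\<And>i. lo i = real_of_int p2 powi (t (i + 1) - 1)"
    and "\<And>i. hi i = real_of_int p1 ^ s i * real_of_int p2 powi (t (i + 1) - t i - 1)"
  shows "(\<forall>i\<ge>1. lo i \<in> \<int> \<and> hi i \<in> \<int> \<and> lo i < hi i \<and>
            {lo i<..<hi i} \<inter> {real_of_int (p1 ^ a * p2 ^ b) | a b :: nat. True} = {})
       \<and> filterlim (\<lambda>i. hi i - lo i) at_top sequentially
       \<and> filterlim (\<lambda>i. (hi i - lo i) / real_of_int p2 ^ i) at_top sequentially"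
proof -
  define \<beta> where "\<beta> = real_of_int p2"
  have \<beta>: "\<beta> > 1" using assms(1,2) by (simp add: \<beta>_def)
  have p1: "real_of_int p1 > 1" "real_of_int p1 < \<beta>" using assms(1,2) by (simp_all add: \<beta>_def)
  have \<alpha>: "\<alpha> = ln (real_of_int p1) / ln \<beta>" by (simp add: assms(4) log_def \<beta>_def)
  have \<beta>\<alpha>: "\<beta> powr \<alpha> = real_of_int p1"
    using \<beta> p1 by (simp add: \<alpha> powr_def)
  interpret irrational_slope \<alpha>
  proof
    show "0 < \<alpha>" "\<alpha> < 1" using \<beta> p1 by (simp_all add: \<alpha>)
    have "log (real_of_int p1) (real_of_int p2) = 1 / \<alpha>" by (simp add: assms(4))
    then show "\<alpha> \<notin> \<rat>" using assms(3) by auto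
  qed
  \<comment> \<open>Records are enumerated from 0 but \<open>s\<close> from 1. At
    \<open>i = 0\<close> truncation gives \<open>r 0 = r 1\<close>, so strict growth is claimed from
    1 on.\<close>
  define r where "r i = nth_record (i - 1)" for i
  define \<epsilon> where "\<epsilon> i = limit_overshoot (r i)" for i
  have s: "s i = Suc (limit_mult (r i))" for i
    by (simp add: assms(5) stabilization_seq_eq r_def)
  have t: "t i = int (r i)" for i
    unfolding assms(6) s floor_Suc_limit_mult ..
  have s\<alpha>: "real (s i) * \<alpha> = real (r i) + \<epsilon> i" for i
    by (simp add: \<epsilon>_def limit_overshoot_def s)
  have \<epsilon>: "0 < \<epsilon> i" "\<epsilon> i < 1" for i
    using limit_overshoot_pos[of "r i"] limit_overshoot_le[of "r i"] less_1
    unfolding \<epsilon>_def by linarith+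
  have r_less: "r i < r (i + 1)" if "i \<ge> 1" for i
    using nth_record_Suc_gt[of "i - 1"] that by (simp add: r_def)
  have p1_powr: "real_of_int p1 ^ a = \<beta> powr (real a * \<alpha>)" for a
    using \<beta> by (simp add: \<beta>\<alpha>[symmetric] powr_powr powr_realpow[symmetric] mult.commute)
  have powi: "\<beta> powi k = \<beta> powr real_of_int k" for k
    using \<beta> by (simp add: powr_real_of_int')
  have lo: "lo i = \<beta> powr (real (r (i + 1)) - 1)" for i
    by (simp add: assms(7) \<beta>_def[symmetric] powi t)
  \<comment> \<open>The integer part \<open>r i\<close> of \<open>s i * \<alpha>\<close> cancels in
    the exponent.\<close>
  have hi: "hi i = \<beta> powr (real (r (i + 1)) - 1 + \<epsilon> i)" for i
    by (simp add: assms(8) \<beta>_def[symmetric] powi t p1_powr s\<alpha> flip: powr_add,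
        simp add: algebra_simps)
  have empty: "x \<notin> {real_of_int (p1 ^ a * p2 ^ b) | a b :: nat. True}"
    if i: "i \<ge> 1" and x: "lo i < x" "x < hi i" for i x
  proof
    assume "x \<in> {real_of_int (p1 ^ a * p2 ^ b) | a b :: nat. True}"
    then obtain a b :: nat where "x = real_of_int p1 ^ a * \<beta> ^ b" by (auto simp: \<beta>_def)
    then have "x = \<beta> powr (real a * \<alpha> + real b)"
      using \<beta> by (simp add: p1_powr powr_add powr_realpow)
    then have ab: "real (r (i + 1)) - 1 < real a * \<alpha> + real b"
        "real a * \<alpha> + real b < real (r (i + 1)) - 1 + \<epsilon> i"
      using x \<beta> by (simp_all add: lo hi)
    have "0 \<le> real a * \<alpha>" using pos by simp
    then have "real b < real (r (i + 1))" using ab \<epsilon>[of i] by linarith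
    then have b: "b < r (i + 1)" by simp
    \<comment> \<open>Write the logarithm of \<open>x\<close> as
      \<open>r (i + 1) - 1 + \<delta>\<close> with \<open>0 < \<delta> < \<epsilon> i\<close>. Then
      \<open>a * \<alpha> = j + \<delta>\<close>, so \<delta> is the overshoot of \<open>j\<close>,
      an index before the next record.\<close>
    define j where "j = r (i + 1) - 1 - b"
    have j: "real j = real (r (i + 1)) - 1 - real b" "j < r (i + 1)"
      using b by (auto simp: j_def)
    have "\<epsilon> i \<le> \<alpha>" by (simp add: \<epsilon>_def limit_overshoot_le)
    then have "limit_overshoot j = real a * \<alpha> - real j"
      using ab j by (intro limit_overshoot_eqI(2)) auto
    then have "limit_overshoot j < \<epsilon> i" using ab j by simp
    moreover have "\<epsilon> i \<le> limit_overshoot j"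
      using limit_overshoot_nth_record_le[of j "i - 1"] j i by (simp add: \<epsilon>_def r_def)
    ultimately show False by simp
  qed
  have interval: "lo i \<in> \<int> \<and> hi i \<in> \<int> \<and> lo i < hi i \<and>
      {lo i<..<hi i} \<inter> {real_of_int (p1 ^ a * p2 ^ b) | a b :: nat. True} = {}"
    if i: "i \<ge> 1" for i
  proof (intro conjI)
    \<comment> \<open>Strict growth of \<open>r\<close> makes both exponents nonnegative.\<close>
    show "lo i \<in> \<int>" "hi i \<in> \<int>"
      using r_less[OF i] by (auto simp: assms(7,8) t power_int_def)
    show "lo i < hi i" using \<beta> \<epsilon>[of i] by (simp add: lo hi)
    show "{lo i<..<hi i} \<inter> {real_of_int (p1 ^ a * p2 ^ b) | a b :: nat. True} = {}"
      using empty[OF i] by fastforce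
  qed
  obtain K where K: "\<And>k. 2 * k \<le> nth_record k + K" using nth_record_ge_double by blast
  define l where "l = ln \<beta>"
  have l: "l > 0" using \<beta> by (simp add: l_def)
  \<comment> \<open>For \<open>x = r (i + 1)\<close>, the exponential is a lower bound for
    \<open>\<beta> powr (x - 1 - i)\<close> by \<open>2 * i \<le> x + K\<close>, and the fraction is
    one for \<open>\<beta> powr \<epsilon> i - 1\<close> by
    \<open>\<epsilon> i \<ge> 1 / s (i + 1)\<close>.\<close>
  define F where "F x = exp (l * (x / 2 - 1 - real K / 2)) * (l * \<alpha> / (x + 1))" for x :: real
  have growth: "F (real (nth_record i)) \<le> (hi i - lo i) / \<beta> ^ i" if i: "i \<ge> 1" for i
  proof -
    define x where "x = real (nth_record i)"
    have x: "real (r (Suc i)) = x" "x \<ge> 0" by (simp_all add: r_def x_def)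
    have "real (s (i + 1)) * \<alpha> \<le> x + 1" using s\<alpha>[of "i + 1"] \<epsilon>(2)[of "i + 1"] x by simp
    then have "\<alpha> / (x + 1) \<le> 1 / real (s (i + 1))"
      using x(2) by (simp add: s field_simps)
    also have "\<dots> \<le> \<epsilon> i"
      using limit_overshoot_nth_record_ge[of "i - 1"] i by (simp add: \<epsilon>_def s r_def)
    finally have "l * (\<alpha> / (x + 1)) \<le> l * \<epsilon> i" using l by (intro mult_left_mono) auto
    also have "\<dots> \<le> \<beta> powr \<epsilon> i - 1"
      using exp_ge_add_one_self[of "\<epsilon> i * l"] \<beta> 
      by (simp add: powr_def l_def algebra_simps)
    finally have 1: "l * \<alpha> / (x + 1) \<le> \<beta> powr \<epsilon> i - 1" by simp
    have "real (2 * i) \<le> real (nth_record i + K)" using K of_nat_le_iff by blast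
    then have "x / 2 - 1 - real K / 2 \<le> x - 1 - real i" by (simp add: x_def)
    then have "exp (l * (x / 2 - 1 - real K / 2)) \<le> \<beta> powr (x - 1 - real i)"
      using \<beta> l by (simp add: powr_def l_def mult.commute)
    then have "F x \<le> \<beta> powr (x - 1 - real i) * (\<beta> powr \<epsilon> i - 1)"
      unfolding F_def using 1 l pos x(2) by (intro mult_mono) auto
    also have "\<dots> = (hi i - lo i) / \<beta> ^ i"
      using \<beta> powr_diff[of \<beta> "x - 1" "real i"]
      by (simp add: lo hi x powr_add powr_realpow right_diff_distrib diff_divide_distrib)
    finally show ?thesis by (simp add: x_def)
  qed
  have "filterlim F at_top at_top" unfolding F_def using l pos by real_asymp
  moreover have "filterlim (\<lambda>i. real (nth_record i)) at_top sequentially"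
    by (rule filterlim_at_top_mono[OF filterlim_real_sequentially])
      (auto simp: nth_record_def le_enumerate[OF infinite_limit_records])
  ultimately have "filterlim (\<lambda>i. F (real (nth_record i))) at_top sequentially"
    by (rule filterlim_compose)
  then have ratio: "filterlim (\<lambda>i. (hi i - lo i) / \<beta> ^ i) at_top sequentially"
    by (rule filterlim_at_top_mono) (use growth in \<open>auto simp: eventually_sequentially\<close>)
  \<comment> \<open>The length is positive and \<open>\<beta> ^ i \<ge> 1\<close>, so divergence of
    the ratio forces divergence of the length.\<close>
  have "(hi i - lo i) / \<beta> ^ i \<le> hi i - lo i" for i
    using \<beta> \<epsilon>(1)[of i] by (simp add: lo hi divide_le_eq mult_le_cancel_left1)
  then have "filterlim (\<lambda>i. hi i - lo i) at_top sequentially"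
    by (intro filterlim_at_top_mono[OF ratio]) auto
  then show ?thesis using interval ratio by (auto simp: \<beta>_def)
qed

end
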